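(* Let $(T_1,T_2)$ be a compatible $\mathcal{O}$-operator on an $A$-bimodule $M$ over an associative algebra $A$. For any formal one-parameter deformation $(T_{1,t}=\sum_{i\ge0}t^iT_{1,i},\ T_{2,t}=\sum_{i\ge0}t^iT_{2,i})$ of $(T_1,T_2)$, its infinitesimal $(T_{1,1},T_{2,1})$ is a $1$-cocycle in the cochain complex $\{C^\bullet_{\mathrm{cO}}(M,A),\delta_{(T_1,T_2)}\}$. Moreover, the corresponding cohomology class in $H^1_{(T_1,T_2)}(M,A)$ depends only on the equivalence class of the deformation (equivalent deformations have cohomologous infinitesimals).
   Context: All vector spaces are over a field $\mathbf{k}$ of characteristic $0$; $\cdot$ denotes the product of $A$ and both actions on $M$. An $\mathcal{O}$-operator on $M$ over $A$ is a linear map $T:M\to A$ with $T(u)\cdot T(v)=T(T(u)\cdot v+u\cdot T(v))$ for all $u,v\in M$. A compatible $\mathcal{O}$-operator is a pair $(T_1,T_2)$ of $\mathcal{O}$-operators such that for all $u,v\in M$ $$T_1(u)\cdot T_2(v)+T_2(u)\cdot T_1(v)=T_1(T_2(u)\cdot v+u\cdot T_2(v))+T_2(T_1(u)\cdot v+u\cdot T_1(v)).$$ A morphism of compatible $\mathcal{O}$-operators from $(T_1,T_2)$ to $(T_1',T_2')$ (on $M$ over $A$) is a pair $(\phi,\psi)$ of an algebra morphism $\phi:A\to A$ and a linear map $\psi:M\to M$ with $\phi\circ T_i=T_i'\circ\psi$ ($i=1,2$), $\psi(a\cdot u)=\phi(a)\cdot\psi(u)$, $\psi(u\cdot a)=\psi(u)\cdot\phi(a)$.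 Cohomology. For linear $T:M\to A$, $a\in A$, $f\in\mathrm{Hom}(M^{\otimes n},A)$, $n\ge1$, put $$[T,a](u)=T(a\cdot u-u\cdot a)+T(u)\cdot a-a\cdot T(u),$$ $$[T,f](u_1,\ldots,u_{n+1})=T(f(u_1,\ldots,u_n)\cdot u_{n+1})-(-1)^nT(u_1\cdot f(u_2,\ldots,u_{n+1}))$$ $$-(-1)^n\Big\{\sum_{i=1}^n(-1)^{i-1}f(u_1,\ldots,u_{i-1},T(u_i)\cdot u_{i+1},u_{i+2},\ldots,u_{n+1})-\sum_{i=1}^n(-1)^if(u_1,\ldots,u_{i-1},u_i\cdot T(u_{i+1}),u_{i+2},\ldots,u_{n+1})\Big\}$$ $$+(-1)^n\big\{T(u_1)\cdot f(u_2,\ldots,u_{n+1})-(-1)^nf(u_1,\ldots,u_n)\cdot T(u_{n+1})\big\}.$$ Let $C^0_{\mathrm{cO}}(M,A)=A$ and, for $n\ge1$, $C^n_{\mathrm{cO}}(M,A)$ be the direct sum of $n+1$ copies of $\mathrm{Hom}(M^{\otimes n},A)$, with differential $\delta_{(T_1,T_2)}(a)=([T_1,a],[T_2,a])$ and $$\delta_{(T_1,T_2)}((f_1,\ldots,f_{n+1}))=\big([T_1,f_1],\ldots,\underbrace{[T_1,f_i]+[T_2,f_{i-1}]}_{i\text{-th place}},\ldots,[T_2,f_{n+1}]\big).$$ The cohomology groups are $H^\bullet_{(T_1,T_2)}(M,A)$. Deformations. $A[[t]]$ is an associative $\mathbf{k}[[t]]$-algebra and $M[[t]]$ an $A[[t]]$-bimodule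 by extending the structures $\mathbf{k}[[t]]$-linearly. A formal one-parameter deformation of $(T_1,T_2)$ is a pair of formal sums $T_{1,t}=\sum_{i\ge0}t^iT_{1,i}$, $T_{2,t}=\sum_{i\ge0}t^iT_{2,i}$ with $T_{1,i},T_{2,i}\in\mathrm{Hom}(M,A)$, $T_{1,0}=T_1$, $T_{2,0}=T_2$, such that $(T_{1,t},T_{2,t})$ is a compatible $\mathcal{O}$-operator on $M[[t]]$ over $A[[t]]$. Its infinitesimal is $(T_{1,1},T_{2,1})$. Two deformations $(T_{1,t},T_{2,t})$ and $(T'_{1,t},T'_{2,t})$ are equivalent if there are $a_0\in A$ and $\phi_i\in\mathrm{Hom}(A,A)$, $\psi_i\in\mathrm{Hom}(M,M)$, $i\ge2$, such that, with $$\phi_t(a)=a+t(a_0\cdot a-a\cdot a_0)+\sum_{i\ge2}t^i\phi_i(a),\qquad\psi_t(u)=u+t(a_0\cdot u-u\cdot a_0)+\sum_{i\ge2}t^i\psi_i(u),$$ $(\phi_t,\psi_t)$ is a morphism of compatible $\mathcal{O}$-operators (over $\mathbf{k}[[t]]$) from $(T_{1,t},T_{2,t})$ to $(T'_{1,t},T'_{2,t})$. *)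

theory Defs
  imports "HOL-Computational_Algebra.Formal_Power_Series" "HOL-Library.Function_Algebras"
begin

unbundle fps_syntax

section \<open>Associative algebras and bimodules\<close>

text \<open>
  The scalars form an arbitrary commutative ring, so that the notions apply both over a field
  \<open>k\<close> and over \<open>k[[t]]\<close>. The class \<^class>\<open>ring\<close> has no unit: algebras are associative but
  need not be unital, and bimodules are correspondingly not required to be unital over \<open>A\<close>.
  Throughout, \<open>sA\<close> and \<open>sM\<close> are the scalar multiplications of \<open>A\<close> and \<open>M\<close>, and \<open>l a u\<close>,
  \<open>r u a\<close> are the left and right actions \<open>a \<cdot> u\<close>, \<open>u \<cdot> a\<close>.
\<close>

locale algebra_bimodule = A: module sA + M: module sM
  for sA :: "'k::comm_ring_1 \<Rightarrow> 'a::ring \<Rightarrow> 'a"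
    and sM :: "'k \<Rightarrow> 'm::ab_group_add \<Rightarrow> 'm" +
  fixes l :: "'a \<Rightarrow> 'm \<Rightarrow> 'm"
    and r :: "'m \<Rightarrow> 'a \<Rightarrow> 'm"
  assumes mult_scale_left: "sA c a * b = sA c (a * b)"
    and mult_scale_right: "a * sA c b = sA c (a * b)"
    and l_add_left: "l (a + b) u = l a u + l b u"
    and l_add_right: "l a (u + v) = l a u + l a v"
    and l_scale_left: "l (sA c a) u = sM c (l a u)"
    and l_scale_right: "l a (sM c u) = sM c (l a u)"
    and r_add_left: "r (u + v) a = r u a + r v a"
    and r_add_right: "r u (a + b) = r u a + r u b"
    and r_scale_left: "r (sM c u) a = sM c (r u a)"
    and r_scale_right: "r u (sA c a) = sM c (r u a)"
    and l_assoc: "l (a * b) u = l a (l b u)"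
    and r_assoc: "r u (a * b) = r (r u a) b"
    and lr_assoc: "r (l a u) b = l a (r u b)"


section \<open>Compatible O-operators\<close>

definition O_operator ::
  "('k::comm_ring_1 \<Rightarrow> 'a::ring \<Rightarrow> 'a) \<Rightarrow> ('k \<Rightarrow> 'm::ab_group_add \<Rightarrow> 'm)
    \<Rightarrow> ('a \<Rightarrow> 'm \<Rightarrow> 'm) \<Rightarrow> ('m \<Rightarrow> 'a \<Rightarrow> 'm) \<Rightarrow> ('m \<Rightarrow> 'a) \<Rightarrow> bool"
  where "O_operator sA sM l r T \<longleftrightarrow>
    module_hom sM sA T \<and> (\<forall>u v. T u * T v = T (l (T u) v + r u (T v)))"

definition compatible_O_operator ::
  "('k::comm_ring_1 \<Rightarrow> 'a::ring \<Rightarrow> 'a) \<Rightarrow> ('k \<Rightarrow> 'm::ab_group_add \<Rightarrow> 'm)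
    \<Rightarrow> ('a \<Rightarrow> 'm \<Rightarrow> 'm) \<Rightarrow> ('m \<Rightarrow> 'a \<Rightarrow> 'm) \<Rightarrow> ('m \<Rightarrow> 'a) \<Rightarrow> ('m \<Rightarrow> 'a) \<Rightarrow> bool"
  where "compatible_O_operator sA sM l r T1 T2 \<longleftrightarrow>
    O_operator sA sM l r T1 \<and> O_operator sA sM l r T2 \<and>
    (\<forall>u v. T1 u * T2 v + T2 u * T1 v =
       T1 (l (T2 u) v + r u (T2 v)) + T2 (l (T1 u) v + r u (T1 v)))"

definition compatible_O_morphism ::
  "('k::comm_ring_1 \<Rightarrow> 'a::ring \<Rightarrow> 'a) \<Rightarrow> ('k \<Rightarrow> 'm::ab_group_add \<Rightarrow> 'm)
    \<Rightarrow> ('a \<Rightarrow> 'm \<Rightarrow> 'm) \<Rightarrow> ('m \<Rightarrow> 'a \<Rightarrow> 'm)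
    \<Rightarrow> ('m \<Rightarrow> 'a) \<Rightarrow> ('m \<Rightarrow> 'a) \<Rightarrow> ('m \<Rightarrow> 'a) \<Rightarrow> ('m \<Rightarrow> 'a)
    \<Rightarrow> ('a \<Rightarrow> 'a) \<Rightarrow> ('m \<Rightarrow> 'm) \<Rightarrow> bool"
  where "compatible_O_morphism sA sM l r T1 T2 T1' T2' \<phi> \<psi> \<longleftrightarrow>
    module_hom sA sA \<phi> \<and> (\<forall>a b. \<phi> (a * b) = \<phi> a * \<phi> b) \<and>
    module_hom sM sM \<psi> \<and>
    \<phi> \<circ> T1 = T1' \<circ> \<psi> \<and> \<phi> \<circ> T2 = T2' \<circ> \<psi> \<and>
    (\<forall>a u. \<psi> (l a u) = l (\<phi> a) (\<psi> u)) \<and>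
    (\<forall>u a. \<psi> (r u a) = r (\<psi> u) (\<phi> a))"


section \<open>The cochain complex\<close>

text \<open>
  \<open>Hom(M\<^sup>\<otimes>\<^sup>n, A)\<close> is the space of \<open>n\<close>-multilinear maps. A multilinear map takes the list
  \<open>[u\<^sub>1, \<dots>, u\<^sub>n]\<close> of its arguments and is \<open>0\<close> on lists of any other length, so that equality
  of cochains is equality of functions.
\<close>

definition multilinear_maps ::
  "('k::comm_ring_1 \<Rightarrow> 'a::ab_group_add \<Rightarrow> 'a) \<Rightarrow> ('k \<Rightarrow> 'm::ab_group_add \<Rightarrow> 'm)
    \<Rightarrow> nat \<Rightarrow> ('m list \<Rightarrow> 'a) set"
  where "multilinear_maps sA sM n =
    {f. (\<forall>us. length us \<noteq> n \<longrightarrow> f us = 0) \<and>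
        (\<forall>us i. length us = n \<longrightarrow> i < n \<longrightarrow> module_hom sM sA (\<lambda>x. f (us[i := x])))}"

definition unary_map :: "('m \<Rightarrow> 'a::zero) \<Rightarrow> 'm list \<Rightarrow> 'a"
  where "unary_map f us = (if length us = 1 then f (us ! 0) else 0)"

definition bracket0 ::
  "('a::ring \<Rightarrow> 'm::ab_group_add \<Rightarrow> 'm) \<Rightarrow> ('m \<Rightarrow> 'a \<Rightarrow> 'm)
    \<Rightarrow> ('m \<Rightarrow> 'a) \<Rightarrow> 'a \<Rightarrow> 'm \<Rightarrow> 'a"
  where "bracket0 l r T a u = T (l a u - r u a) + T u * a - a * T u"

text \<open>
  Lists are indexed from 0: the argument \<open>u\<^sub>i\<close> is \<open>us ! (i - 1)\<close>, and \<open>u\<^sub>2, \<dots>, u\<^sub>n\<^sub>+\<^sub>1\<close> and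
  \<open>u\<^sub>1, \<dots>, u\<^sub>n\<close> are \<open>drop 1 us\<close> and \<open>take n us\<close>.
\<close>

definition bracket ::
  "('k::comm_ring_1 \<Rightarrow> 'a::ring \<Rightarrow> 'a) \<Rightarrow> ('a \<Rightarrow> 'm \<Rightarrow> 'm) \<Rightarrow> ('m \<Rightarrow> 'a \<Rightarrow> 'm)
    \<Rightarrow> ('m \<Rightarrow> 'a) \<Rightarrow> nat \<Rightarrow> ('m list \<Rightarrow> 'a) \<Rightarrow> 'm list \<Rightarrow> 'a"
  where "bracket sA l r T n f us =
    (if length us \<noteq> n + 1 then 0 else
       T (l (f (take n us)) (us ! n))
       - sA ((-1) ^ n) (T (r (us ! 0) (f (drop 1 us))))
       - sA ((-1) ^ n)
           ((\<Sum>i=1..n. sA ((-1) ^ (i - 1))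
               (f (take (i - 1) us @ [l (T (us ! (i - 1))) (us ! i)] @ drop (i + 1) us)))
            - (\<Sum>i=1..n. sA ((-1) ^ i)
               (f (take (i - 1) us @ [r (us ! (i - 1)) (T (us ! i))] @ drop (i + 1) us))))
       + sA ((-1) ^ n)
           (T (us ! 0) * f (drop 1 us) - sA ((-1) ^ n) (f (take n us) * T (us ! n))))"

text \<open>
  For \<open>n \<ge> 1\<close>, an element \<open>(f\<^sub>1, \<dots>, f\<^sub>n\<^sub>+\<^sub>1)\<close> of \<open>C\<^sup>n\<close> is the family \<open>F\<close> with \<open>F i = f\<^sub>i\<close> for
  \<open>1 \<le> i \<le> n + 1\<close> and \<open>F i = 0\<close> for all other \<open>i\<close>. The space \<open>C\<^sup>0\<close> is the type \<open>'a\<close> itself;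
  its differential is \<open>cO_diff0\<close>.
\<close>

definition cO_cochains ::
  "('k::comm_ring_1 \<Rightarrow> 'a::ab_group_add \<Rightarrow> 'a) \<Rightarrow> ('k \<Rightarrow> 'm::ab_group_add \<Rightarrow> 'm)
    \<Rightarrow> nat \<Rightarrow> (nat \<Rightarrow> 'm list \<Rightarrow> 'a) set"
  where "cO_cochains sA sM n =
    {F. (\<forall>i\<in>{1..n+1}. F i \<in> multilinear_maps sA sM n) \<and> (\<forall>i. i \<notin> {1..n+1} \<longrightarrow> F i = 0)}"

definition unary_pair :: "('m \<Rightarrow> 'a::zero) \<Rightarrow> ('m \<Rightarrow> 'a) \<Rightarrow> nat \<Rightarrow> 'm list \<Rightarrow> 'a"
  where "unary_pair f g i = (if i = 1 then unary_map f else if i = 2 then unary_map g else 0)"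

definition cO_diff0 ::
  "('a::ring \<Rightarrow> 'm::ab_group_add \<Rightarrow> 'm) \<Rightarrow> ('m \<Rightarrow> 'a \<Rightarrow> 'm)
    \<Rightarrow> ('m \<Rightarrow> 'a) \<Rightarrow> ('m \<Rightarrow> 'a) \<Rightarrow> 'a \<Rightarrow> nat \<Rightarrow> 'm list \<Rightarrow> 'a"
  where "cO_diff0 l r T1 T2 a = unary_pair (bracket0 l r T1 a) (bracket0 l r T2 a)"

definition cO_diff ::
  "('k::comm_ring_1 \<Rightarrow> 'a::ring \<Rightarrow> 'a) \<Rightarrow> ('a \<Rightarrow> 'm \<Rightarrow> 'm) \<Rightarrow> ('m \<Rightarrow> 'a \<Rightarrow> 'm)
    \<Rightarrow> ('m \<Rightarrow> 'a) \<Rightarrow> ('m \<Rightarrow> 'a) \<Rightarrow> nat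
    \<Rightarrow> (nat \<Rightarrow> 'm list \<Rightarrow> 'a) \<Rightarrow> nat \<Rightarrow> 'm list \<Rightarrow> 'a"
  where "cO_diff sA l r T1 T2 n F i =
    (if i = 1 then bracket sA l r T1 n (F 1)
     else if 2 \<le> i \<and> i \<le> n + 1 then bracket sA l r T1 n (F i) + bracket sA l r T2 n (F (i - 1))
     else if i = n + 2 then bracket sA l r T2 n (F (n + 1))
     else 0)"

text \<open>
  Cocycles, coboundaries and cohomology in degrees \<open>n \<ge> 1\<close>; a cohomology class is a coset of
  the space of coboundaries.
\<close>

definition cO_cocycles ::
  "('k::comm_ring_1 \<Rightarrow> 'a::ring \<Rightarrow> 'a) \<Rightarrow> ('k \<Rightarrow> 'm::ab_group_add \<Rightarrow> 'm)
    \<Rightarrow> ('a \<Rightarrow> 'm \<Rightarrow> 'm) \<Rightarrow> ('m \<Rightarrow> 'a \<Rightarrow> 'm) \<Rightarrow> ('m \<Rightarrow> 'a) \<Rightarrow> ('m \<Rightarrow> 'a)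
    \<Rightarrow> nat \<Rightarrow> (nat \<Rightarrow> 'm list \<Rightarrow> 'a) set"
  where "cO_cocycles sA sM l r T1 T2 n =
    {F \<in> cO_cochains sA sM n. cO_diff sA l r T1 T2 n F = 0}"

definition cO_coboundaries ::
  "('k::comm_ring_1 \<Rightarrow> 'a::ring \<Rightarrow> 'a) \<Rightarrow> ('k \<Rightarrow> 'm::ab_group_add \<Rightarrow> 'm)
    \<Rightarrow> ('a \<Rightarrow> 'm \<Rightarrow> 'm) \<Rightarrow> ('m \<Rightarrow> 'a \<Rightarrow> 'm) \<Rightarrow> ('m \<Rightarrow> 'a) \<Rightarrow> ('m \<Rightarrow> 'a)
    \<Rightarrow> nat \<Rightarrow> (nat \<Rightarrow> 'm list \<Rightarrow> 'a) set"
  where "cO_coboundaries sA sM l r T1 T2 n =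
    (if n = 1 then range (cO_diff0 l r T1 T2)
     else cO_diff sA l r T1 T2 (n - 1) ` cO_cochains sA sM (n - 1))"

definition cO_class ::
  "('k::comm_ring_1 \<Rightarrow> 'a::ring \<Rightarrow> 'a) \<Rightarrow> ('k \<Rightarrow> 'm::ab_group_add \<Rightarrow> 'm)
    \<Rightarrow> ('a \<Rightarrow> 'm \<Rightarrow> 'm) \<Rightarrow> ('m \<Rightarrow> 'a \<Rightarrow> 'm) \<Rightarrow> ('m \<Rightarrow> 'a) \<Rightarrow> ('m \<Rightarrow> 'a)
    \<Rightarrow> nat \<Rightarrow> (nat \<Rightarrow> 'm list \<Rightarrow> 'a) \<Rightarrow> (nat \<Rightarrow> 'm list \<Rightarrow> 'a) set"
  where "cO_class sA sM l r T1 T2 n F = (\<lambda>B. F + B) ` cO_coboundaries sA sM l r T1 T2 n"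

definition cO_cohomology ::
  "('k::comm_ring_1 \<Rightarrow> 'a::ring \<Rightarrow> 'a) \<Rightarrow> ('k \<Rightarrow> 'm::ab_group_add \<Rightarrow> 'm)
    \<Rightarrow> ('a \<Rightarrow> 'm \<Rightarrow> 'm) \<Rightarrow> ('m \<Rightarrow> 'a \<Rightarrow> 'm) \<Rightarrow> ('m \<Rightarrow> 'a) \<Rightarrow> ('m \<Rightarrow> 'a)
    \<Rightarrow> nat \<Rightarrow> (nat \<Rightarrow> 'm list \<Rightarrow> 'a) set set"
  where "cO_cohomology sA sM l r T1 T2 n =
    cO_class sA sM l r T1 T2 n ` cO_cocycles sA sM l r T1 T2 n"


section \<open>Formal deformations\<close>

text \<open>
  \<open>A[[t]]\<close> and \<open>M[[t]]\<close> are the types \<open>'a fps\<close> and \<open>'m fps\<close>. The product of \<open>A[[t]]\<close> is the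
  library's multiplication of power series; \<open>fps_bilinear\<close> extends the scalar multiplications
  and the two actions by the same Cauchy product formula.
\<close>

definition fps_bilinear :: "('x \<Rightarrow> 'y \<Rightarrow> 'z::comm_monoid_add) \<Rightarrow> 'x fps \<Rightarrow> 'y fps \<Rightarrow> 'z fps"
  where "fps_bilinear b x y = Abs_fps (\<lambda>n. \<Sum>i=0..n. b (x $ i) (y $ (n - i)))"

text \<open>The map \<open>\<Sum>\<^sub>i t\<^sup>i f\<^sub>i\<close> on power series, for a sequence of linear maps \<open>f\<^sub>i\<close>.\<close>

definition fps_formal_sum :: "(nat \<Rightarrow> 'x \<Rightarrow> 'y::comm_monoid_add) \<Rightarrow> 'x fps \<Rightarrow> 'y fps"
  where "fps_formal_sum f x = Abs_fps (\<lambda>n. \<Sum>i=0..n. f i (x $ (n - i)))"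

definition formal_deformation ::
  "('k::comm_ring_1 \<Rightarrow> 'a::ring \<Rightarrow> 'a) \<Rightarrow> ('k \<Rightarrow> 'm::ab_group_add \<Rightarrow> 'm)
    \<Rightarrow> ('a \<Rightarrow> 'm \<Rightarrow> 'm) \<Rightarrow> ('m \<Rightarrow> 'a \<Rightarrow> 'm) \<Rightarrow> ('m \<Rightarrow> 'a) \<Rightarrow> ('m \<Rightarrow> 'a)
    \<Rightarrow> (nat \<Rightarrow> 'm \<Rightarrow> 'a) \<Rightarrow> (nat \<Rightarrow> 'm \<Rightarrow> 'a) \<Rightarrow> bool"
  where "formal_deformation sA sM l r T1 T2 T1t T2t \<longleftrightarrow>
    (\<forall>i. module_hom sM sA (T1t i)) \<and> (\<forall>i. module_hom sM sA (T2t i)) \<and>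
    T1t 0 = T1 \<and> T2t 0 = T2 \<and>
    compatible_O_operator (fps_bilinear sA) (fps_bilinear sM) (fps_bilinear l) (fps_bilinear r)
      (fps_formal_sum T1t) (fps_formal_sum T2t)"

definition infinitesimal ::
  "(nat \<Rightarrow> 'm \<Rightarrow> 'a::zero) \<Rightarrow> (nat \<Rightarrow> 'm \<Rightarrow> 'a) \<Rightarrow> nat \<Rightarrow> 'm list \<Rightarrow> 'a"
  where "infinitesimal T1t T2t = unary_pair (T1t 1) (T2t 1)"

definition equivalent_deformations ::
  "('k::comm_ring_1 \<Rightarrow> 'a::ring \<Rightarrow> 'a) \<Rightarrow> ('k \<Rightarrow> 'm::ab_group_add \<Rightarrow> 'm)
    \<Rightarrow> ('a \<Rightarrow> 'm \<Rightarrow> 'm) \<Rightarrow> ('m \<Rightarrow> 'a \<Rightarrow> 'm)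
    \<Rightarrow> (nat \<Rightarrow> 'm \<Rightarrow> 'a) \<Rightarrow> (nat \<Rightarrow> 'm \<Rightarrow> 'a)
    \<Rightarrow> (nat \<Rightarrow> 'm \<Rightarrow> 'a) \<Rightarrow> (nat \<Rightarrow> 'm \<Rightarrow> 'a) \<Rightarrow> bool"
  where "equivalent_deformations sA sM l r T1t T2t T1t' T2t' \<longleftrightarrow>
    (\<exists>a0 \<phi> \<psi>.
       \<phi> 0 = (\<lambda>a. a) \<and> \<phi> 1 = (\<lambda>a. a0 * a - a * a0) \<and> (\<forall>i\<ge>2. module_hom sA sA (\<phi> i)) \<and>
       \<psi> 0 = (\<lambda>u. u) \<and> \<psi> 1 = (\<lambda>u. l a0 u - r u a0) \<and> (\<forall>i\<ge>2. module_hom sM sM (\<psi> i)) \<and>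
       compatible_O_morphism
         (fps_bilinear sA) (fps_bilinear sM) (fps_bilinear l) (fps_bilinear r)
         (fps_formal_sum T1t) (fps_formal_sum T2t) (fps_formal_sum T1t') (fps_formal_sum T2t')
         (fps_formal_sum \<phi>) (fps_formal_sum \<psi>))"


section \<open>Well-definedness\<close>

text \<open>\<open>A[[t]]\<close> is an associative \<open>k[[t]]\<close>-algebra and \<open>M[[t]]\<close> is an \<open>A[[t]]\<close>-bimodule.\<close>

lemma fps_times_eq_fps_bilinear:
  fixes x :: "'a::{comm_monoid_add,times} fps"
  shows "x * y = fps_bilinear (*) x y"
  by (simp add: fps_eq_iff fps_bilinear_def fps_mult_nth)

lemma fps_bilinear_add_left:
  assumes "\<And>a b c. f (a + b) c = f a c + f b c"
  shows "fps_bilinear f (x + y) z = fps_bilinear f x z + fps_bilinear f y z"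
  by (simp add: fps_eq_iff fps_bilinear_def assms sum.distrib)

lemma fps_bilinear_add_right:
  assumes "\<And>a b c. f c (a + b) = f c a + f c b"
  shows "fps_bilinear f z (x + y) = fps_bilinear f z x + fps_bilinear f z y"
  by (simp add: fps_eq_iff fps_bilinear_def assms sum.distrib)

lemma fps_bilinear_assoc:
  fixes f :: "'x \<Rightarrow> 'y \<Rightarrow> 'p::ab_group_add" and g :: "'p \<Rightarrow> 'z \<Rightarrow> 'w::ab_group_add"
    and h :: "'y \<Rightarrow> 'z \<Rightarrow> 'q::ab_group_add" and e :: "'x \<Rightarrow> 'q \<Rightarrow> 'w"
  assumes g: "\<And>a b c. g (a + b) c = g a c + g b c"
    and e: "\<And>a b c. e a (b + c) = e a b + e a c"
    and eq: "\<And>a b c. g (f a b) c = e a (h b c)"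
  shows "fps_bilinear g (fps_bilinear f x y) z = fps_bilinear e x (fps_bilinear h y z)"
proof (rule fps_ext)
  fix n
  have gs: "g (sum k S) c = (\<Sum>i\<in>S. g (k i) c)" for k :: "nat \<Rightarrow> 'p" and S c
    using Modules.additive.sum[of "\<lambda>a. g a c" k S] by (simp add: Modules.additive_def g)
  have es: "e a (sum k S) = (\<Sum>i\<in>S. e a (k i))" for k :: "nat \<Rightarrow> 'q" and S a
    using Modules.additive.sum[of "e a" k S] by (simp add: Modules.additive_def e)
  have "(\<Sum>j=0..n. \<Sum>i=0..j. e (x$i) (h (y$(j - i)) (z$(n - j)))) =
        (\<Sum>j=0..n. \<Sum>i=0..n - j. e (x$j) (h (y$i) (z$(n - j - i))))"
    by (rule fps_mult_assoc_lemma)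
  then show "fps_bilinear g (fps_bilinear f x y) z $ n = fps_bilinear e x (fps_bilinear h y z) $ n"
    by (simp add: fps_bilinear_def gs es eq)
qed

lemma fps_bilinear_flip:
  "fps_bilinear f x y = fps_bilinear (\<lambda>b a. f a b) y x"
proof (rule fps_ext)
  fix n
  show "fps_bilinear f x y $ n = fps_bilinear (\<lambda>b a. f a b) y x $ n"
    using fps_mult_commute_lemma[of "\<lambda>i j. f (x $ i) (y $ j)" n]
    by (simp add: fps_bilinear_def)
qed

lemma fps_bilinear_assoc_flip:
  fixes f :: "'x \<Rightarrow> 'y \<Rightarrow> 'p::ab_group_add" and g :: "'z \<Rightarrow> 'p \<Rightarrow> 'w::ab_group_add"
    and h :: "'z \<Rightarrow> 'y \<Rightarrow> 'q::ab_group_add" and e :: "'x \<Rightarrow> 'q \<Rightarrow> 'w"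
  assumes "\<And>a b c. g c (a + b) = g c a + g c b"
    and "\<And>a b c. e a (b + c) = e a b + e a c"
    and "\<And>a b c. g c (f a b) = e a (h c b)"
  shows "fps_bilinear g z (fps_bilinear f x y) = fps_bilinear e x (fps_bilinear h z y)"
  unfolding fps_bilinear_flip[of g] fps_bilinear_flip[of h]
  by (rule fps_bilinear_assoc) (use assms in auto)

lemma fps_module:
  fixes s :: "'k::comm_ring_1 \<Rightarrow> 'v::ab_group_add \<Rightarrow> 'v"
  assumes "module s"
  shows "module (fps_bilinear s)"
proof -
  interpret module s by fact
  show ?thesis
  proof
    fix a b :: "'k fps" and x y :: "'v fps"
    show "fps_bilinear s a (x + y) = fps_bilinear s a x + fps_bilinear s a y"
      by (simp add: fps_bilinear_add_right scale_right_distrib)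
    show "fps_bilinear s (a + b) x = fps_bilinear s a x + fps_bilinear s b x"
      by (simp add: fps_bilinear_add_left scale_left_distrib)
    show "fps_bilinear s a (fps_bilinear s b x) = fps_bilinear s (a * b) x"
      unfolding fps_times_eq_fps_bilinear
      by (rule fps_bilinear_assoc[symmetric]) (simp_all add: scale_right_distrib scale_left_distrib)
    have "(\<Sum>i=0..n. s (1 $ i) (x $ (n - i))) = x $ n" for n
    proof -
      have "(\<Sum>i=0..n. s (1 $ i) (x $ (n - i))) = (\<Sum>i=0..n. if i = 0 then x $ n else 0)"
        by (rule sum.cong) auto
      then show ?thesis by simp
    qed
    then show "fps_bilinear s 1 x = x"
      by (simp add: fps_eq_iff fps_bilinear_def)
  qed
qed

theorem algebra_bimodule_fps:
  assumes "algebra_bimodule sA sM l r"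
  shows "algebra_bimodule (fps_bilinear sA) (fps_bilinear sM) (fps_bilinear l) (fps_bilinear r)"
proof -
  interpret algebra_bimodule sA sM l r by fact
  note add_simps = distrib_left distrib_right l_add_left l_add_right r_add_left r_add_right
    A.scale_right_distrib A.scale_left_distrib M.scale_right_distrib M.scale_left_distrib
  note scale_simps = mult_scale_left mult_scale_right l_scale_left l_scale_right
    r_scale_left r_scale_right l_assoc r_assoc lr_assoc
  show ?thesis
    apply (intro algebra_bimodule.intro algebra_bimodule_axioms.intro fps_module
        A.module_axioms M.module_axioms)
    unfolding fps_times_eq_fps_bilinear
    by (rule fps_bilinear_add_left fps_bilinear_add_right fps_bilinear_assoc
        fps_bilinear_assoc_flip fps_bilinear_assoc[symmetric] fps_bilinear_assoc_flip[symmetric];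
        simp add: add_simps scale_simps)+
qed

text \<open>Coboundaries are cocycles in degree 1.\<close>

lemma cO_coboundaries_1_subset_cocycles:
  assumes "algebra_bimodule sA sM l r" and "compatible_O_operator sA sM l r T1 T2"
  shows "cO_coboundaries sA sM l r T1 T2 1 \<subseteq> cO_cocycles sA sM l r T1 T2 1"
proof
  interpret algebra_bimodule sA sM l r by fact
  have O1: "O_operator sA sM l r T1" and O2: "O_operator sA sM l r T2"
    and C: "T1 u * T2 v + T2 u * T1 v =
       T1 (l (T2 u) v + r u (T2 v)) + T2 (l (T1 u) v + r u (T1 v))" for u v
    using assms(2) by (auto simp: compatible_O_operator_def)
  interpret T1: module_hom sM sA T1 using O1 by (simp add: O_operator_def)
  interpret T2: module_hom sM sA T2 using O2 by (simp add: O_operator_def)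
  have R1: "T1 u * T1 v = T1 (l (T1 u) v) + T1 (r u (T1 v))" for u v
    using O1 by (simp add: O_operator_def T1.add)
  have R2: "T2 u * T2 v = T2 (l (T2 u) v) + T2 (r u (T2 v))" for u v
    using O2 by (simp add: O_operator_def T2.add)
  have C': "T1 u * T2 v = T1 (l (T2 u) v) + T1 (r u (T2 v)) + T2 (l (T1 u) v) + T2 (r u (T1 v))
      - T2 u * T1 v" for u v
    using C[of u v] by (simp add: T1.add T2.add algebra_simps)
  have l_diff: "l (a - b) u = l a u - l b u" "l a (u - v) = l a u - l a v" for a b u v
    using l_add_left[of "a - b" b u] l_add_right[of a "u - v" v] by (simp_all add: eq_diff_eq)
  have r_diff: "r (u - v) a = r u a - r v a" "r u (a - b) = r u a - r u b" for a b u v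
    using r_add_left[of "u - v" v a] r_add_right[of u "a - b" b] by (simp_all add: eq_diff_eq)
  fix F
  assume "F \<in> cO_coboundaries sA sM l r T1 T2 1"
  then obtain a where F: "F = cO_diff0 l r T1 T2 a"
    by (auto simp: cO_coboundaries_def)
  have hom: "unary_map (bracket0 l r T a) \<in> multilinear_maps sA sM 1"
    if "module_hom sM sA T" for T
  proof -
    interpret T: module_hom sM sA T by fact
    have "module_hom sM sA (bracket0 l r T a)"
      by unfold_locales
        (simp_all add: bracket0_def T.add T.diff T.scale l_add_right r_add_left l_scale_right
          r_scale_left mult_scale_left mult_scale_right A.scale_right_diff_distrib
          A.scale_right_distrib algebra_simps)
    then show ?thesis
      by (auto simp: multilinear_maps_def unary_map_def)
  qed
  have len2: "\<exists>u v. us = [u, v]" if "length us = 2" for us :: "'m list"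
    using that by (auto simp: numeral_2_eq_2 length_Suc_conv)
  have br: "bracket sA l r T 1 (unary_map f) us = 0" if "length us \<noteq> 2" for T f us
    using that by (simp add: bracket_def)
  have br2: "bracket sA l r T 1 (unary_map f) [u, v] =
      T (l (f u) v) + T (r u (f v)) + f (l (T u) v) + f (r u (T v)) - T u * f v - f u * T v"
    for T f u v
    by (simp add: bracket_def unary_map_def)
  note ds = bracket0_def T1.add T1.diff T2.add T2.diff l_diff r_diff l_add_left l_add_right
    r_add_left r_add_right l_assoc r_assoc lr_assoc
  have R1': "T1 u * (T1 v * x) = T1 (l (T1 u) v) * x + T1 (r u (T1 v)) * x" for u v x
    by (simp add: R1 mult.assoc[symmetric] distrib_right)
  have R2': "T2 u * (T2 v * x) = T2 (l (T2 u) v) * x + T2 (r u (T2 v)) * x" for u v x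
    by (simp add: R2 mult.assoc[symmetric] distrib_right)
  have C'': "T1 u * (T2 v * x) = T1 (l (T2 u) v) * x + T1 (r u (T2 v)) * x
      + T2 (l (T1 u) v) * x + T2 (r u (T1 v)) * x - T2 u * (T1 v * x)" for u v x
    by (simp add: C' mult.assoc[symmetric] distrib_right left_diff_distrib)
  have b11: "bracket sA l r T1 1 (unary_map (bracket0 l r T1 a)) us = 0" for us
  proof (cases "length us = 2")
    case True
    then obtain u v where us: "us = [u, v]" using len2 by blast
    show ?thesis unfolding us br2
      by (simp add: ds R1 R1' algebra_simps)
  qed (use br in auto)
  have b22: "bracket sA l r T2 1 (unary_map (bracket0 l r T2 a)) us = 0" for us
  proof (cases "length us = 2")
    case True
    then obtain u v where us: "us = [u, v]" using len2 by blast
    show ?thesis unfolding us br2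
      by (simp add: ds R2 R2' algebra_simps)
  qed (use br in auto)
  have b12: "bracket sA l r T1 1 (unary_map (bracket0 l r T2 a)) us +
      bracket sA l r T2 1 (unary_map (bracket0 l r T1 a)) us = 0" for us
  proof (cases "length us = 2")
    case True
    then obtain u v where us: "us = [u, v]" using len2 by blast
    show ?thesis unfolding us br2
      by (simp add: ds R1 R1' R2 R2' C' C'' algebra_simps)
  qed (use br in auto)
  have "cO_diff sA l r T1 T2 1 F = 0"
    using b11 b22 b12 by (auto simp: fun_eq_iff cO_diff_def F cO_diff0_def unary_pair_def)
  moreover have "F \<in> cO_cochains sA sM 1"
    using hom[OF T1.module_hom_axioms] hom[OF T2.module_hom_axioms]
    by (auto simp: cO_cochains_def F cO_diff0_def unary_pair_def)
  ultimately show "F \<in> cO_cocycles sA sM l r T1 T2 1"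
    by (simp add: cO_cocycles_def)
qed

end

theory Submission
  imports Defs
begin

text \<open>
  The defining identities of a deformation are identities of power series, and on constant series
  \<open>u\<close>, \<open>v\<close> their coefficients can be read off degree by degree. The infinitesimal is seen by the
  coefficient of \<open>t\<close>, which is the linearisation at \<open>(T\<^sub>1, T\<^sub>2)\<close> of the corresponding identity.

  The operator identity of \<open>T\<^sub>i\<^sub>,\<^sub>t\<close> gives \<open>[T\<^sub>i, T\<^sub>i\<^sub>,\<^sub>1] = 0\<close> and the compatibility identity gives
  \<open>[T\<^sub>1, T\<^sub>2\<^sub>,\<^sub>1] + [T\<^sub>2, T\<^sub>1\<^sub>,\<^sub>1] = 0\<close>. These three equations are the three components of the cocycle
  condition (\<open>cO_cocycles_1_unary_pair_iff\<close>). Likewise, since an equivalence is given in degree 1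
  by the inner derivations of one element \<open>a\<^sub>0\<close>, the coefficient of \<open>t\<close> in
  \<open>\<phi>\<^sub>t \<circ> T\<^sub>i\<^sub>,\<^sub>t = T'\<^sub>i\<^sub>,\<^sub>t \<circ> \<psi>\<^sub>t\<close> says that \<open>T\<^sub>i\<^sub>,\<^sub>1 - T'\<^sub>i\<^sub>,\<^sub>1 = [T\<^sub>i, a\<^sub>0]\<close> for both \<open>i\<close> at once, so the two
  infinitesimals differ by the coboundary of \<open>a\<^sub>0\<close>
  (\<open>equivalent_infinitesimals_differ_by_coboundary\<close>). Adding a coboundary does not move the coset,
  because the differential is additive in \<open>a\<^sub>0\<close> (\<open>cO_class_1_cohomologous\<close>).
\<close>

lemma fps_bilinear_nth_0: "fps_bilinear b x y $ 0 = b (x $ 0) (y $ 0)"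
  by (simp add: fps_bilinear_def)

lemma fps_bilinear_nth_1:
  "fps_bilinear b x y $ 1 = b (x $ 0) (y $ 1) + b (x $ 1) (y $ 0)"
  by (simp add: fps_bilinear_def)

lemma fps_formal_sum_nth_0: "fps_formal_sum f x $ 0 = f 0 (x $ 0)"
  by (simp add: fps_formal_sum_def)

lemma fps_formal_sum_nth_1:
  "fps_formal_sum f x $ 1 = f 0 (x $ 1) + f 1 (x $ 0)"
  by (simp add: fps_formal_sum_def)

context algebra_bimodule
begin

lemma action_zero_simps:
  "l 0 u = 0" "l a 0 = 0" "r 0 a = 0" "r u 0 = 0"
  using l_add_left[of 0 0 u] l_add_right[of a 0 0] r_add_left[of 0 0 a] r_add_right[of u 0 0]
  by simp_all

text \<open>
  The next two lemmas give the coefficient of \<open>t\<close> of the two sides of the operator and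
  compatibility identities. On constant series the only contributions are those in which one of
  the two operators has index 1 and the other index 0, which is the product rule. Allowing two
  different families \<open>S\<close>, \<open>T\<close> covers both identities.
\<close>

lemma formal_sum_product_nth_1:
  assumes "\<And>i. module_hom sM sA (S i)" and "\<And>i. module_hom sM sA (T i)"
  shows "(fps_formal_sum S (fps_const u) * fps_formal_sum T (fps_const v)) $ 1 =
    S 0 u * T 1 v + S 1 u * T 0 v"
  using assms[THEN module_hom.zero]
  by (simp add: fps_times_eq_fps_bilinear fps_bilinear_nth_1 fps_formal_sum_nth_0
      fps_formal_sum_nth_1 del: One_nat_def)

lemma formal_sum_action_nth_1:
  assumes "\<And>i. module_hom sM sA (T i)"
  shows "fps_formal_sum S
      (fps_bilinear l (fps_formal_sum T (fps_const u)) (fps_const v)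
        + fps_bilinear r (fps_const u) (fps_formal_sum T (fps_const v))) $ 1 =
    S 0 (l (T 1 u) v + r u (T 1 v)) + S 1 (l (T 0 u) v + r u (T 0 v))"
  using assms[THEN module_hom.zero]
  by (simp add: fps_bilinear_nth_0 fps_bilinear_nth_1 fps_formal_sum_nth_0 fps_formal_sum_nth_1
      action_zero_simps del: One_nat_def)

text \<open>
  In degree 1 the bracket is the linearisation, in the direction \<open>f\<close>, of the defect
  \<open>T (T u \<cdot> v + u \<cdot> T v) - T u \<cdot> T v\<close> of the operator identity at \<open>T\<close>.
\<close>

lemma bracket_1_unary_map:
  assumes "module_hom sM sA T" and "module_hom sM sA f"
  shows "bracket sA l r T 1 (unary_map f) [u, v] =
    T (l (f u) v + r u (f v)) + f (l (T u) v + r u (T v)) - (T u * f v + f u * T v)"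
  using assms[THEN module_hom.add]
  by (simp add: bracket_def unary_map_def)

lemma unary_map_multilinear:
  assumes "module_hom sM sA f"
  shows "unary_map f \<in> multilinear_maps sA sM 1"
  using assms by (auto simp: multilinear_maps_def unary_map_def)

text \<open>
  The complex has three components in degree 2, each a function of two arguments; so being a
  cocycle amounts to three equations on pairs \<open>u\<close>, \<open>v\<close>, the form in which the
  linearised identities appear.
\<close>

lemma cO_cocycles_1_unary_pair_iff:
  assumes "module_hom sM sA f" and "module_hom sM sA g"
  shows "unary_pair f g \<in> cO_cocycles sA sM l r T1 T2 1 \<longleftrightarrow>
    (\<forall>u v. bracket sA l r T1 1 (unary_map f) [u, v] = 0) \<and>
    (\<forall>u v. bracket sA l r T1 1 (unary_map g) [u, v] + bracket sA l r T2 1 (unary_map f) [u, v] = 0) \<and>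
    (\<forall>u v. bracket sA l r T2 1 (unary_map g) [u, v] = 0)"
proof -
  have cochain: "unary_pair f g \<in> cO_cochains sA sM 1"
    using assms[THEN unary_map_multilinear] by (auto simp: cO_cochains_def unary_pair_def)
  \<comment> \<open>A bracket in degree 2 vanishes by convention on lists that do not have two entries.\<close>
  have binary: "(\<forall>us. H us = 0) \<longleftrightarrow> (\<forall>u v. H [u, v] = 0)"
    if "\<And>us. length us \<noteq> 2 \<Longrightarrow> H us = 0" for H :: "'m list \<Rightarrow> 'a"
  proof
    assume H: "\<forall>u v. H [u, v] = 0"
    show "\<forall>us. H us = 0"
    proof
      fix us
      show "H us = 0"
        using that[of us] H
        by (cases "length us = 2") (auto simp: numeral_2_eq_2 length_Suc_conv)
    qed
  qed simp
  have "cO_diff sA l r T1 T2 1 (unary_pair f g) = 0 \<longleftrightarrow>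
    (\<forall>us. bracket sA l r T1 1 (unary_map f) us = 0) \<and>
    (\<forall>us. bracket sA l r T1 1 (unary_map g) us + bracket sA l r T2 1 (unary_map f) us = 0) \<and>
    (\<forall>us. bracket sA l r T2 1 (unary_map g) us = 0)" (is "?D = 0 \<longleftrightarrow> ?R")
  proof
    assume D: "?D = 0"
    have "?D 1 us = 0" "?D 2 us = 0" "?D 3 us = 0" for us
      by (simp_all only: D zero_fun_apply)
    then show ?R by (simp add: cO_diff_def unary_pair_def)
  next
    assume ?R
    then show "?D = 0" by (auto simp: fun_eq_iff cO_diff_def unary_pair_def)
  qed
  also have "(\<forall>us. bracket sA l r T1 1 (unary_map f) us = 0) \<longleftrightarrow>
      (\<forall>u v. bracket sA l r T1 1 (unary_map f) [u, v] = 0)"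
    by (rule binary) (simp add: bracket_def)
  also have "(\<forall>us. bracket sA l r T1 1 (unary_map g) us + bracket sA l r T2 1 (unary_map f) us = 0) \<longleftrightarrow>
      (\<forall>u v. bracket sA l r T1 1 (unary_map g) [u, v] + bracket sA l r T2 1 (unary_map f) [u, v] = 0)"
    by (rule binary) (simp add: bracket_def)
  also have "(\<forall>us. bracket sA l r T2 1 (unary_map g) us = 0) \<longleftrightarrow>
      (\<forall>u v. bracket sA l r T2 1 (unary_map g) [u, v] = 0)"
    by (rule binary) (simp add: bracket_def)
  finally show ?thesis using cochain by (simp add: cO_cocycles_def zero_fun_def)
qed

proposition infinitesimal_in_cO_cocycles:
  assumes "formal_deformation sA sM l r T1 T2 T1t T2t"
  shows "infinitesimal T1t T2t \<in> cO_cocycles sA sM l r T1 T2 1"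
proof -
  have lin: "\<And>i. module_hom sM sA (T1t i)" "\<And>i. module_hom sM sA (T2t i)"
    and start: "T1 = T1t 0" "T2 = T2t 0"
    and comp: "compatible_O_operator (fps_bilinear sA) (fps_bilinear sM) (fps_bilinear l)
      (fps_bilinear r) (fps_formal_sum T1t) (fps_formal_sum T2t)"
    using assms by (auto simp: formal_deformation_def)
  note coeff_simps = fps_add_nth formal_sum_product_nth_1[OF lin(1) lin(1)]
    formal_sum_product_nth_1[OF lin(1) lin(2)] formal_sum_product_nth_1[OF lin(2) lin(1)]
    formal_sum_product_nth_1[OF lin(2) lin(2)]
    formal_sum_action_nth_1[OF lin(1)] formal_sum_action_nth_1[OF lin(2)]
  have linearised_O: "bracket sA l r (T 0) 1 (unary_map (T 1)) [u, v] = 0"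
    if T: "\<And>i. module_hom sM sA (T i)"
      and O: "O_operator (fps_bilinear sA) (fps_bilinear sM) (fps_bilinear l) (fps_bilinear r)
        (fps_formal_sum T)" for T u v
  proof -
    have "(fps_formal_sum T (fps_const u) * fps_formal_sum T (fps_const v)) $ 1 =
      fps_formal_sum T
        (fps_bilinear l (fps_formal_sum T (fps_const u)) (fps_const v)
          + fps_bilinear r (fps_const u) (fps_formal_sum T (fps_const v))) $ 1"
      using O by (simp add: O_operator_def)
    then show ?thesis
      unfolding formal_sum_product_nth_1[OF T T] formal_sum_action_nth_1[OF T]
        bracket_1_unary_map[OF T T] by simp
  qed
  have linearised_compatibility: "bracket sA l r (T1t 0) 1 (unary_map (T2t 1)) [u, v]
      + bracket sA l r (T2t 0) 1 (unary_map (T1t 1)) [u, v] = 0" for u v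
  proof -
    have "(fps_formal_sum T1t (fps_const u) * fps_formal_sum T2t (fps_const v)
        + fps_formal_sum T2t (fps_const u) * fps_formal_sum T1t (fps_const v)) $ 1 =
      (fps_formal_sum T1t
        (fps_bilinear l (fps_formal_sum T2t (fps_const u)) (fps_const v)
          + fps_bilinear r (fps_const u) (fps_formal_sum T2t (fps_const v)))
      + fps_formal_sum T2t
        (fps_bilinear l (fps_formal_sum T1t (fps_const u)) (fps_const v)
          + fps_bilinear r (fps_const u) (fps_formal_sum T1t (fps_const v)))) $ 1"
      using comp by (simp add: compatible_O_operator_def)
    then show ?thesis
      unfolding coeff_simps bracket_1_unary_map[OF lin(1) lin(2)]
        bracket_1_unary_map[OF lin(2) lin(1)]
      by (simp add: algebra_simps)
  qed
  show ?thesis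
    unfolding infinitesimal_def cO_cocycles_1_unary_pair_iff[OF lin(1) lin(2)] start
    using linearised_O[of T1t, OF lin(1)] linearised_O[of T2t, OF lin(2)] linearised_compatibility comp
    by (simp add: compatible_O_operator_def)
qed

text \<open>
  On a constant series, the coefficient of \<open>t\<close> of \<open>\<phi>\<^sub>t \<circ> T\<^sub>t = T'\<^sub>t \<circ> \<psi>\<^sub>t\<close> involves the degree 1 parts
  of \<open>\<phi>\<^sub>t\<close> and \<open>\<psi>\<^sub>t\<close> only through \<open>a\<^sub>0 \<cdot> T u - T u \<cdot> a\<^sub>0\<close> and \<open>T (a\<^sub>0 \<cdot> u - u \<cdot> a\<^sub>0)\<close>, whose difference is
  \<open>[T, a\<^sub>0] u\<close>. The same \<open>a\<^sub>0\<close> serves both operators, as a coboundary requires.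
\<close>

proposition equivalent_infinitesimals_differ_by_coboundary:
  assumes "formal_deformation sA sM l r T1 T2 T1t T2t"
    and "formal_deformation sA sM l r T1 T2 T1t' T2t'"
    and "equivalent_deformations sA sM l r T1t T2t T1t' T2t'"
  obtains a where
    "infinitesimal T1t T2t = infinitesimal T1t' T2t' + cO_diff0 l r T1 T2 a"
proof -
  obtain a0 \<phi> \<psi> where
    \<phi>: "\<phi> 0 = (\<lambda>a. a)" "\<phi> 1 = (\<lambda>a. a0 * a - a * a0)"
    and \<psi>: "\<psi> 0 = (\<lambda>u. u)" "\<psi> 1 = (\<lambda>u. l a0 u - r u a0)"
    and inter: "fps_formal_sum \<phi> \<circ> fps_formal_sum T1t = fps_formal_sum T1t' \<circ> fps_formal_sum \<psi>"
      "fps_formal_sum \<phi> \<circ> fps_formal_sum T2t = fps_formal_sum T2t' \<circ> fps_formal_sum \<psi>"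
    using assms(3) unfolding equivalent_deformations_def compatible_O_morphism_def by blast
  have degree_1: "T 1 u = T' 1 u + bracket0 l r S a0 u"
    if "module_hom sM sA S" and "T 0 = S" and "T' 0 = S"
      and TT': "fps_formal_sum \<phi> \<circ> fps_formal_sum T = fps_formal_sum T' \<circ> fps_formal_sum \<psi>"
    for S T T' u
  proof -
    have "fps_formal_sum \<phi> (fps_formal_sum T (fps_const u)) $ 1 =
      fps_formal_sum T' (fps_formal_sum \<psi> (fps_const u)) $ 1"
      using fun_cong[OF TT', of "fps_const u"] by simp
    then have "T 1 u + (a0 * S u - S u * a0) = S (l a0 u - r u a0) + T' 1 u"
      using module_hom.zero[OF that(1)]
      by (simp add: fps_formal_sum_nth_0 fps_formal_sum_nth_1 \<phi> \<psi> that del: One_nat_def)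
    then show ?thesis by (simp add: bracket0_def algebra_simps)
  qed
  have "module_hom sM sA T1" "module_hom sM sA T2" "T1t 0 = T1" "T2t 0 = T2" "T1t' 0 = T1" "T2t' 0 = T2"
    using assms(1,2) by (auto simp: formal_deformation_def)
  then have "T1t 1 u = T1t' 1 u + bracket0 l r T1 a0 u" "T2t 1 u = T2t' 1 u + bracket0 l r T2 a0 u" for u
    using degree_1 inter by blast+
  then have "infinitesimal T1t T2t = infinitesimal T1t' T2t' + cO_diff0 l r T1 T2 a0"
    by (simp add: fun_eq_iff infinitesimal_def cO_diff0_def unary_pair_def unary_map_def
        del: One_nat_def)
  then show thesis by (rule that)
qed

lemma cO_diff0_add:
  assumes "module_hom sM sA T1" and "module_hom sM sA T2"
  shows "cO_diff0 l r T1 T2 (a + b) = cO_diff0 l r T1 T2 a + cO_diff0 l r T1 T2 b"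
proof -
  have "bracket0 l r T (a + b) u = bracket0 l r T a u + bracket0 l r T b u"
    if "module_hom sM sA T" for T u
    unfolding bracket0_def l_add_left r_add_right add_diff_add module_hom.add[OF that]
    by (simp add: algebra_simps)
  then show ?thesis
    using assms by (simp add: fun_eq_iff cO_diff0_def unary_pair_def unary_map_def)
qed

text \<open>
  The coset of \<open>F\<close> is that of \<open>G\<close> with the parameter \<open>b\<close> of the coboundary replaced by \<open>a + b\<close>,
  and translation by \<open>a\<close> is a permutation of the algebra.
\<close>

lemma cO_class_1_cohomologous:
  assumes "module_hom sM sA T1" and "module_hom sM sA T2"
    and "F = G + cO_diff0 l r T1 T2 a"
  shows "cO_class sA sM l r T1 T2 1 F = cO_class sA sM l r T1 T2 1 G"
proof -
  let ?d = "cO_diff0 l r T1 T2"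
  have "cO_class sA sM l r T1 T2 1 F = range (\<lambda>b. F + ?d b)"
    by (simp add: cO_class_def cO_coboundaries_def image_image)
  also have "\<dots> = (\<lambda>b. G + ?d b) ` range (\<lambda>b. a + b)"
    by (simp only: image_image assms(3) cO_diff0_add[OF assms(1,2)] add.assoc)
  also have "\<dots> = cO_class sA sM l r T1 T2 1 G"
    by (simp add: cO_class_def cO_coboundaries_def image_image surj_plus)
  finally show ?thesis .
qed

end

theorem theorem4p3:
  fixes sA :: "'k::field_char_0 \<Rightarrow> 'a::ring \<Rightarrow> 'a"
    and sM :: "'k \<Rightarrow> 'm::ab_group_add \<Rightarrow> 'm"
    and l :: "'a \<Rightarrow> 'm \<Rightarrow> 'm" and r :: "'m \<Rightarrow> 'a \<Rightarrow> 'm"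
    and T1 T2 :: "'m \<Rightarrow> 'a"
  assumes "algebra_bimodule sA sM l r"
    and "compatible_O_operator sA sM l r T1 T2"
  shows "(\<forall>T1t T2t. formal_deformation sA sM l r T1 T2 T1t T2t \<longrightarrow>
            infinitesimal T1t T2t \<in> cO_cocycles sA sM l r T1 T2 1 \<and>
            cO_class sA sM l r T1 T2 1 (infinitesimal T1t T2t) \<in> cO_cohomology sA sM l r T1 T2 1) \<and>
         (\<forall>T1t T2t T1t' T2t'.
            formal_deformation sA sM l r T1 T2 T1t T2t \<longrightarrow>
            formal_deformation sA sM l r T1 T2 T1t' T2t' \<longrightarrow>
            equivalent_deformations sA sM l r T1t T2t T1t' T2t' \<longrightarrow>
            cO_class sA sM l r T1 T2 1 (infinitesimal T1t T2t) =
            cO_class sA sM l r T1 T2 1 (infinitesimal T1t' T2t'))"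
proof -
  interpret algebra_bimodule sA sM l r by fact
  have lin: "module_hom sM sA T1" "module_hom sM sA T2"
    using assms(2) by (auto simp: compatible_O_operator_def O_operator_def)
  show ?thesis
    using infinitesimal_in_cO_cocycles equivalent_infinitesimals_differ_by_coboundary
      cO_class_1_cohomologous[OF lin]
    unfolding cO_cohomology_def by (metis imageI)
qed

end
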